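(* Let $\theta\in(0,1)$, let $X_1,X_2,\ldots$ be i.i.d. random variables uniformly distributed on $[0,1]$, let $N=\inf\{n\ge 1: X_n>1-\theta\}$, and, on the event $\{N\ge 2\}$, let $$Y=\max_{1\le i\le N-1}X_i .$$ Then, conditionally on the event $\{N\ge2\}$, the random variable $Y$ has probability density function $$g(y)=\frac{\theta}{(1-\theta)(1-y)^2},\qquad 0\le y\le 1-\theta,$$ and $g(y)=0$ for $y\notin[0,1-\theta]$.
   Context: This is the Correlated Standard Uniform Geometric (CSUG) model for the maximum: uniform trials are conducted until one exceeds $1-\theta$, and one takes the maximum of the trials preceding that one. Conditionally on $N\ge 2$, $N$ has probability mass function $\mathbb P(N=n\mid N\ge 2)=\theta(1-\theta)^{n-2}$, $n=2,3,\ldots$. Densities are with respect to Lebesgue measure. *)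

theory Defs
  imports "HOL-Probability.Probability" "HOL-Library.Extended_Nat"
begin

text \<open>The trials are \<open>X 1, X 2, \<dots>\<close>; \<open>X 0\<close> is never used. The infimum is taken in \<^typ>\<open>enat\<close>,
  so that it is \<open>\<infinity>\<close> when no trial exceeds \<open>1 - \<theta>\<close>.\<close>

definition csug_N :: "real \<Rightarrow> (nat \<Rightarrow> 'a \<Rightarrow> real) \<Rightarrow> 'a \<Rightarrow> enat" where
  "csug_N \<theta> X \<omega> = Inf {enat n | n. n \<ge> 1 \<and> X n \<omega> > 1 - \<theta>}"

text \<open>The maximum is meaningful when \<open>2 \<le> N < \<infinity>\<close>. The value \<open>0\<close> elsewhere only makes the function
  total: \<open>N = 1\<close> lies outside the conditioning event, and \<open>N = \<infinity>\<close> has probability zero in the model.\<close>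

definition csug_max :: "real \<Rightarrow> (nat \<Rightarrow> 'a \<Rightarrow> real) \<Rightarrow> 'a \<Rightarrow> real" where
  "csug_max \<theta> X \<omega> =
     (if 2 \<le> csug_N \<theta> X \<omega> \<and> csug_N \<theta> X \<omega> < \<infinity>
      then Max ((\<lambda>i. X i \<omega>) ` {1..the_enat (csug_N \<theta> X \<omega>) - 1})
      else 0)"

end

theory Submission
  imports Defs
begin

text \<open>Write \<open>a = 1 - \<theta>\<close>. The event \<open>N \<ge> 2\<close> is \<open>X 1 \<le> a\<close>, of probability \<open>a\<close>. With
  \<open>p = max 0 (min t a)\<close>, the event \<open>N = n + 1, Y \<le> t\<close> says that \<open>X 1, \<dots>, X n\<close> are at most
  \<open>min t a\<close> and \<open>X (n + 1) > a\<close>, so it has probability \<open>p ^ n * \<theta>\<close>. Since \<open>N\<close> is almost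
  surely finite, summing the geometric series over \<open>n \<ge> 1\<close> gives the conditional distribution
  function \<open>\<theta> * p / (a * (1 - p))\<close>, which is the integral of the claimed density up to \<open>t\<close>.\<close>

section \<open>Pointwise description of \<open>csug_N\<close> and \<open>csug_max\<close> by
  inequalities on the trials\<close>

lemma csug_N_eq_enat_iff:
  "csug_N \<theta> X \<omega> = enat k \<longleftrightarrow> 1 \<le> k \<and> 1 - \<theta> < X k \<omega> \<and> (\<forall>i\<in>{1..<k}. X i \<omega> \<le> 1 - \<theta>)"
proof -
  let ?A = "{enat n | n. n \<ge> 1 \<and> X n \<omega> > 1 - \<theta>}"
  show ?thesis
  proof
    assume N: "csug_N \<theta> X \<omega> = enat k"
    then have "Inf ?A = enat k" by (simp add: csug_N_def)
    \<comment> \<open>In \<open>enat\<close> the infimum of the empty set is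
      \<open>\<infinity>\<close>, so a finite infimum forces \<open>?A\<close> to be nonempty, and
      by well-ordering it is then attained.\<close>
    moreover from this have "?A \<noteq> {}"
      by (metis Inf_empty enat.distinct(1) top_enat_def)
    ultimately have "enat k \<in> ?A"
      using wellorder_InfI[of _ ?A] by fastforce
    moreover have "X i \<omega> \<le> 1 - \<theta>" if "i \<in> {1..<k}" for i
    proof (rule ccontr)
      assume "\<not> X i \<omega> \<le> 1 - \<theta>"
      with that have "enat i \<in> ?A" by auto
      then have "Inf ?A \<le> enat i" by (rule Inf_lower)
      with \<open>Inf ?A = enat k\<close> that show False by simp
    qed
    ultimately show "1 \<le> k \<and> 1 - \<theta> < X k \<omega> \<and> (\<forall>i\<in>{1..<k}. X i \<omega> \<le> 1 - \<theta>)" by auto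
  next
    assume k: "1 \<le> k \<and> 1 - \<theta> < X k \<omega> \<and> (\<forall>i\<in>{1..<k}. X i \<omega> \<le> 1 - \<theta>)"
    have "Inf ?A = enat k"
    proof (rule antisym)
      show "Inf ?A \<le> enat k" using k by (intro Inf_lower) auto
      show "enat k \<le> Inf ?A"
      proof (rule Inf_greatest)
        fix m assume "m \<in> ?A"
        then show "enat k \<le> m" using k by (force simp: not_le[symmetric])
      qed
    qed
    then show "csug_N \<theta> X \<omega> = enat k" by (simp add: csug_N_def)
  qed
qed

lemma csug_N_eq_infinity_iff: "csug_N \<theta> X \<omega> = \<infinity> \<longleftrightarrow> (\<forall>n\<ge>1. X n \<omega> \<le> 1 - \<theta>)"
proof -
  \<comment> \<open>An infimum is the top element only if every member is; all members here are
    finite, so the set must be empty.\<close>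
  have "csug_N \<theta> X \<omega> = \<infinity> \<longleftrightarrow> (\<forall>m\<in>{enat n | n. n \<ge> 1 \<and> X n \<omega> > 1 - \<theta>}. m = \<infinity>)"
    unfolding csug_N_def top_enat_def[symmetric] by (rule Inf_top_conv(1))
  then show ?thesis by (simp add: not_less[symmetric]) blast
qed

text \<open>Reduces the conditioning event to a condition on one trial. The outcome
  \<open>N = \<infinity>\<close> satisfies both sides, so the equivalence holds at every
  point.\<close>

lemma two_le_csug_N_iff: "2 \<le> csug_N \<theta> X \<omega> \<longleftrightarrow> X 1 \<omega> \<le> 1 - \<theta>"
proof (cases "csug_N \<theta> X \<omega>")
  case (enat k)
  then have k: "1 \<le> k" "1 - \<theta> < X k \<omega>" "\<forall>i\<in>{1..<k}. X i \<omega> \<le> 1 - \<theta>"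
    by (simp_all add: csug_N_eq_enat_iff)
  have "2 \<le> csug_N \<theta> X \<omega> \<longleftrightarrow> 2 \<le> k"
    unfolding enat by (metis enat_ord_simps(1) numeral_eq_enat)
  moreover have "2 \<le> k" if "X 1 \<omega> \<le> 1 - \<theta>" using k that by (cases "k = 1") auto
  ultimately show ?thesis using k by auto
next
  case infinity
  then show ?thesis using csug_N_eq_infinity_iff[of \<theta> X \<omega>] by simp
qed

text \<open>The witness is \<open>n = N - 2\<close>, so the maximum runs over the nonempty range
  \<open>{1..Suc n}\<close>. The bound \<open>t\<close> on the maximum and the bound
  \<open>1 - \<theta>\<close> on trials before the first exceedance merge into one
  \<open>min\<close>. Finiteness is stated explicitly because at \<open>N = \<infinity>\<close> the
  default value \<open>0\<close> could also lie below \<open>t\<close>.\<close>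

lemma two_le_csug_N_and_max_le_iff:
  "2 \<le> csug_N \<theta> X \<omega> \<and> csug_N \<theta> X \<omega> < \<infinity> \<and> csug_max \<theta> X \<omega> \<le> t \<longleftrightarrow>
    (\<exists>n. (\<forall>i\<in>{1..Suc n}. X i \<omega> \<le> min t (1 - \<theta>)) \<and> 1 - \<theta> < X (n + 2) \<omega>)"
proof
  assume L: "2 \<le> csug_N \<theta> X \<omega> \<and> csug_N \<theta> X \<omega> < \<infinity> \<and> csug_max \<theta> X \<omega> \<le> t"
  then obtain k where k: "csug_N \<theta> X \<omega> = enat k" by auto
  with L have "2 \<le> k" by (metis enat_ord_simps(1) numeral_eq_enat)
  then obtain n where n: "k = n + 2" by (metis add.commute le_Suc_ex)
  have "Max ((\<lambda>i. X i \<omega>) ` {1..Suc n}) \<le> t"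
    using L by (simp add: csug_max_def k n)
  then have "\<forall>i\<in>{1..Suc n}. X i \<omega> \<le> t" by (subst (asm) Max_le_iff) auto
  with k show "\<exists>n. (\<forall>i\<in>{1..Suc n}. X i \<omega> \<le> min t (1 - \<theta>)) \<and> 1 - \<theta> < X (n + 2) \<omega>"
    unfolding n csug_N_eq_enat_iff by (intro exI[of _ n]) auto
next
  assume "\<exists>n. (\<forall>i\<in>{1..Suc n}. X i \<omega> \<le> min t (1 - \<theta>)) \<and> 1 - \<theta> < X (n + 2) \<omega>"
  then obtain n where n: "\<forall>i\<in>{1..Suc n}. X i \<omega> \<le> min t (1 - \<theta>)" "1 - \<theta> < X (n + 2) \<omega>"
    by blast
  then have N: "csug_N \<theta> X \<omega> = enat (n + 2)" by (subst csug_N_eq_enat_iff) auto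
  have N2: "2 \<le> csug_N \<theta> X \<omega>" using n by (subst two_le_csug_N_iff) auto
  have "csug_max \<theta> X \<omega> = Max ((\<lambda>i. X i \<omega>) ` {1..Suc n})"
    unfolding csug_max_def using N N2 by simp
  also have "\<dots> \<le> t" using n by (subst Max_le_iff) auto
  finally show "2 \<le> csug_N \<theta> X \<omega> \<and> csug_N \<theta> X \<omega> < \<infinity> \<and> csug_max \<theta> X \<omega> \<le> t"
    using N N2 by simp
qed

section \<open>Measurability\<close>

lemma measurable_csug_N:
  assumes [measurable]: "\<And>i. i \<ge> 1 \<Longrightarrow> X i \<in> borel_measurable M"
  shows "csug_N \<theta> X \<in> M \<rightarrow>\<^sub>M count_space UNIV"
  unfolding measurable_count_space_eq_countable[OF countableI_type]
proof (intro conjI ballI)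
  show "csug_N \<theta> X \<in> space M \<rightarrow> UNIV" by simp
  fix m :: enat
  show "csug_N \<theta> X -` {m} \<inter> space M \<in> sets M"
  proof (cases m)
    case (enat k)
    have "csug_N \<theta> X -` {m} \<inter> space M =
        {\<omega> \<in> space M. 1 \<le> k \<and> 1 - \<theta> < X k \<omega> \<and> (\<forall>i\<in>{1..<k}. X i \<omega> \<le> 1 - \<theta>)}"
      by (auto simp: enat csug_N_eq_enat_iff)
    also have "\<dots> \<in> sets M"
      \<comment> \<open>Measurability is given from index 1 on, so \<open>k = 0\<close> is split
        off; the set is then empty.\<close>
      by (cases "1 \<le> k") (auto intro!: sets.sets_Collect_conj sets.sets_Collect_finite_All')
    finally show ?thesis .
  next
    case infinity
    have "csug_N \<theta> X -` {m} \<inter> space M = (\<Inter>n\<in>{1..}. {\<omega> \<in> space M. X n \<omega> \<le> 1 - \<theta>})"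
      by (auto simp: infinity csug_N_eq_infinity_iff)
    also have "\<dots> \<in> sets M"
      by (rule sets.countable_INT') auto
    finally show ?thesis .
  qed
qed

text \<open>The number of trials under the maximum is random. For each fixed value \<open>m\<close>
  of \<open>N\<close> the function \<open>?F m\<close> is a finite maximum or constant, and
  countably many such pieces are glued along \<open>N\<close>.\<close>

lemma borel_measurable_csug_max:
  assumes [measurable]: "\<And>i. i \<ge> 1 \<Longrightarrow> X i \<in> borel_measurable M"
  shows "csug_max \<theta> X \<in> borel_measurable M"
proof -
  let ?F = "\<lambda>(m::enat) \<omega>. if 2 \<le> m \<and> m < \<infinity> then Max ((\<lambda>i. X i \<omega>) ` {1..the_enat m - 1}) else 0"
  have "(\<lambda>\<omega>. ?F (csug_N \<theta> X \<omega>) \<omega>) \<in> borel_measurable M"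
  proof (rule measurable_compose_countable'[OF _ measurable_csug_N])
    fix m :: enat
    show "?F m \<in> borel_measurable M"
    proof (cases "2 \<le> m \<and> m < \<infinity>")
      case True
      have "(\<lambda>\<omega>. Max ((\<lambda>i. X i \<omega>) ` {1..the_enat m - 1})) \<in> borel_measurable M"
        by (rule borel_measurable_Max) auto
      then show ?thesis by (simp only: True simp_thms if_True)
    next
      case False
      then show ?thesis by (simp only: if_False borel_measurable_const)
    qed
  qed simp_all
  also have "(\<lambda>\<omega>. ?F (csug_N \<theta> X \<omega>) \<omega>) = csug_max \<theta> X"
    by (simp add: csug_max_def fun_eq_iff)
  finally show ?thesis .
qed

section \<open>Integral of the claimed density over a half-line\<close>

lemma nn_integral_csug_density_atMost:
  fixes \<theta> t :: real
  assumes \<theta>: "0 < \<theta>" "\<theta> < 1"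
  defines "p \<equiv> max 0 (min t (1 - \<theta>))"
  shows "(\<integral>\<^sup>+y. ennreal ((if 0 \<le> y \<and> y \<le> 1 - \<theta> then \<theta> / ((1 - \<theta>) * (1 - y)\<^sup>2) else 0)
            * indicator {..t} y) \<partial>lborel) = ennreal (\<theta> * p / ((1 - \<theta>) * (1 - p)))"
proof (cases "t < 0")
  case True
  then have "(\<lambda>y. ennreal ((if 0 \<le> y \<and> y \<le> 1 - \<theta> then \<theta> / ((1 - \<theta>) * (1 - y)\<^sup>2) else 0)
            * indicator {..t} y)) = (\<lambda>_. 0)"
    by (auto simp: fun_eq_iff indicator_def)
  then show ?thesis using True by (simp add: p_def max_def)
next
  case False
  then have p: "p = min t (1 - \<theta>)" "0 \<le> p" "p < 1" using \<theta> by (auto simp: p_def)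
  have "(\<integral>\<^sup>+y. ennreal ((if 0 \<le> y \<and> y \<le> 1 - \<theta> then \<theta> / ((1 - \<theta>) * (1 - y)\<^sup>2) else 0)
            * indicator {..t} y) \<partial>lborel)
      = (\<integral>\<^sup>+y. ennreal (\<theta> / ((1 - \<theta>) * (1 - y)\<^sup>2)) * indicator {0..p} y \<partial>lborel)"
    by (intro nn_integral_cong) (auto simp: p indicator_def)
  also have "\<dots> = ennreal (\<theta> / ((1 - \<theta>) * (1 - p)) - \<theta> / ((1 - \<theta>) * (1 - 0)))"
  \<comment> \<open>The antiderivative has its pole at 1, and \<open>p < 1\<close> keeps the
    interval \<open>{0..p}\<close> away from it.\<close>
  proof (rule nn_integral_FTC_Icc[where F = "\<lambda>x. \<theta> / ((1 - \<theta>) * (1 - x))"])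
    fix x assume "x \<in> {0..p}"
    then have "1 - x \<noteq> 0" using p by auto
    then have "((\<lambda>x. c / (1 - x)) has_real_derivative c / (1 - x)\<^sup>2) (at x)" for c
      by (auto intro!: derivative_eq_intros simp: power2_eq_square)
    from this[of "\<theta> / (1 - \<theta>)"]
    show "((\<lambda>x. \<theta> / ((1 - \<theta>) * (1 - x))) has_real_derivative \<theta> / ((1 - \<theta>) * (1 - x)\<^sup>2)) (at x)"
      by simp
  qed (use \<theta> p in auto)
  also have "\<theta> / ((1 - \<theta>) * (1 - p)) - \<theta> / ((1 - \<theta>) * (1 - 0)) = \<theta> * p / ((1 - \<theta>) * (1 - p))"
    using \<theta> p by (simp add: divide_simps) (simp add: algebra_simps)
  finally show ?thesis .
qed

section \<open>The probability model and its elementary events\<close>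

locale csug = prob_space M for M :: "'a measure" +
  fixes X :: "nat \<Rightarrow> 'a \<Rightarrow> real" and \<theta> :: real
  assumes theta: "0 < \<theta>" "\<theta> < 1"
    and indep: "indep_vars (\<lambda>_. borel) X {1..}"
    and uniform: "\<And>i. i \<ge> 1 \<Longrightarrow> distr M borel (X i) = uniform_measure lborel {0..1}"
begin

lemma X_measurable [measurable]: "i \<ge> 1 \<Longrightarrow> X i \<in> borel_measurable M"
  using indep by (auto simp: indep_vars_def)

lemma prob_X_le:
  assumes "i \<ge> 1" "s \<le> 1"
  shows "prob {\<omega> \<in> space M. X i \<omega> \<le> s} = max 0 s"
proof -
  have [measurable]: "X i \<in> borel_measurable M" using assms(1) by simp
  have "prob {\<omega> \<in> space M. X i \<omega> \<le> s} = measure (distr M borel (X i)) {..s}"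
    by (subst measure_distr) (auto intro!: arg_cong[where f = prob])
  also have "\<dots> = measure lborel ({0..1} \<inter> {..s}) / measure lborel {0..1::real}"
    unfolding uniform[OF assms(1)] by (rule measure_uniform_measure) auto
  \<comment> \<open>This uses \<open>s \<le> 1\<close>. For negative \<open>s\<close> the interval
    is empty, which accounts for the \<open>max 0 s\<close>.\<close>
  also have "{0..1} \<inter> {..s} = {0..s}" using assms by auto
  finally show ?thesis by (auto simp: max_def measure_def emeasure_lborel_Icc_eq)
qed

lemma prob_X_greater:
  assumes "i \<ge> 1"
  shows "prob {\<omega> \<in> space M. 1 - \<theta> < X i \<omega>} = \<theta>"
proof -
  have [measurable]: "X i \<in> borel_measurable M" using assms by simp
  have "{\<omega> \<in> space M. 1 - \<theta> < X i \<omega>} = space M - {\<omega> \<in> space M. X i \<omega> \<le> 1 - \<theta>}" by auto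
  then show ?thesis using theta assms by (simp add: prob_compl prob_X_le)
qed

lemma prob_all_X_le:
  assumes "s \<le> 1"
  shows "prob {\<omega> \<in> space M. \<forall>i\<in>{1..Suc n}. X i \<omega> \<le> s} = max 0 s ^ Suc n"
proof -
  have "{\<omega> \<in> space M. \<forall>i\<in>{1..Suc n}. X i \<omega> \<le> s} = (\<Inter>i\<in>{1..Suc n}. X i -` {..s} \<inter> space M)"
    by auto
  also have "prob \<dots> = (\<Prod>i\<in>{1..Suc n}. prob (X i -` {..s} \<inter> space M))"
    by (rule indep_varsD[OF indep]) auto
  also have "\<dots> = (\<Prod>i\<in>{1..Suc n}. max 0 s)"
    using prob_X_le[OF _ assms] by (intro prod.cong) (auto simp: vimage_def Int_def conj_commute)
  finally show ?thesis by simp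
qed

lemma prob_all_X_le_then_greater:
  assumes "s \<le> 1"
  shows "prob {\<omega> \<in> space M. (\<forall>i\<in>{1..Suc n}. X i \<omega> \<le> s) \<and> 1 - \<theta> < X (n + 2) \<omega>}
           = max 0 s ^ Suc n * \<theta>"
proof -
  \<comment> \<open>Both kinds of constraint form one family of Borel sets, so a single application
    of independence covers all \<open>n + 2\<close> trials.\<close>
  let ?B = "\<lambda>i. if i = n + 2 then {1 - \<theta><..} else {..s}"
  have *: "{1..n + 2} = insert (n + 2) {1..Suc n}" by auto
  have "{\<omega> \<in> space M. (\<forall>i\<in>{1..Suc n}. X i \<omega> \<le> s) \<and> 1 - \<theta> < X (n + 2) \<omega>}
      = (\<Inter>i\<in>{1..n + 2}. X i -` ?B i \<inter> space M)"
    unfolding * by auto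
  also have "prob \<dots> = (\<Prod>i\<in>{1..n + 2}. prob (X i -` ?B i \<inter> space M))"
    by (rule indep_varsD[OF indep]) auto
  also have "\<dots> = (\<Prod>i\<in>{1..n + 2}. if i = n + 2 then \<theta> else max 0 s)"
    using prob_X_le[OF _ assms] prob_X_greater
    by (intro prod.cong) (auto simp: vimage_def Int_def conj_commute)
  also have "\<dots> = \<theta> * (\<Prod>i\<in>{1..Suc n}. max 0 s)"
    unfolding * by (subst prod.insert) (auto intro!: prod.cong)
  finally show ?thesis by simp
qed

text \<open>If \<open>N = \<infinity>\<close>, the first \<open>n + 1\<close> trials are all at most
  \<open>1 - \<theta>\<close>, which has probability \<open>(1 - \<theta>) ^ Suc n\<close>, and this
  tends to 0.\<close>

lemma AE_csug_N_finite: "AE \<omega> in M. csug_N \<theta> X \<omega> < \<infinity>"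
proof -
  let ?S = "{\<omega> \<in> space M. \<forall>n\<ge>1. X n \<omega> \<le> 1 - \<theta>}"
  have "?S = (\<Inter>n\<in>{1..}. {\<omega> \<in> space M. X n \<omega> \<le> 1 - \<theta>})" by auto
  also have "\<dots> \<in> sets M" by (rule sets.countable_INT') auto
  finally have S: "?S \<in> sets M" .
  have "prob ?S \<le> (1 - \<theta>) ^ Suc n" for n
  proof -
    have "prob ?S \<le> prob {\<omega> \<in> space M. \<forall>i\<in>{1..Suc n}. X i \<omega> \<le> 1 - \<theta>}"
      by (intro finite_measure_mono sets.sets_Collect_finite_All') auto
    then show ?thesis using theta prob_all_X_le[of "1 - \<theta>" n] by simp
  qed
  moreover have "(\<lambda>n. (1 - \<theta>) ^ Suc n) \<longlonglongrightarrow> 0"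
    using theta by (intro LIMSEQ_Suc LIMSEQ_power_zero) auto
  ultimately have "prob ?S \<le> 0" by (intro LIMSEQ_le_const) auto
  then have "emeasure M ?S = 0"
    by (simp add: emeasure_eq_measure measure_le_0_iff)
  with S have "AE \<omega> in M. \<not> (\<forall>n\<ge>1. X n \<omega> \<le> 1 - \<theta>)"
    by (intro AE_I[where N = ?S]) auto
  then show ?thesis
    unfolding csug_N_eq_infinity_iff[symmetric] by eventually_elim (simp add: less_infinityE)
qed

section \<open>Distribution function and density of the maximum\<close>

lemma prob_csug_max_le:
  fixes t :: real
  defines "p \<equiv> max 0 (min t (1 - \<theta>))"
  shows "prob {\<omega> \<in> space M. 2 \<le> csug_N \<theta> X \<omega> \<and> csug_max \<theta> X \<omega> \<le> t} = \<theta> * p / (1 - p)"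
proof -
  let ?E = "\<lambda>n. {\<omega> \<in> space M. (\<forall>i\<in>{1..Suc n}. X i \<omega> \<le> min t (1 - \<theta>)) \<and> 1 - \<theta> < X (n + 2) \<omega>}"
  have [measurable]: "csug_N \<theta> X \<in> M \<rightarrow>\<^sub>M count_space UNIV" "csug_max \<theta> X \<in> borel_measurable M"
    by (simp_all add: measurable_csug_N borel_measurable_csug_max)
  have E: "range ?E \<subseteq> sets M"
    by (auto intro!: sets.sets_Collect_conj sets.sets_Collect_finite_All')
  have U: "(\<Union>n. ?E n) =
      {\<omega> \<in> space M. 2 \<le> csug_N \<theta> X \<omega> \<and> csug_N \<theta> X \<omega> < \<infinity> \<and> csug_max \<theta> X \<omega> \<le> t}"
    unfolding two_le_csug_N_and_max_le_iff by auto
  have "disjoint_family ?E"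
    unfolding disjoint_family_on_def
  proof (intro ballI impI)
    fix m n :: nat assume "m \<noteq> n"
    \<comment> \<open>The exceedance required by the smaller index is among the trials that the
      larger index keeps at most \<open>1 - \<theta>\<close>.\<close>
    then have "m + 2 \<in> {1..Suc n} \<or> n + 2 \<in> {1..Suc m}" by auto
    then show "?E m \<inter> ?E n = {}" by fastforce
  qed
  with E have "(\<lambda>n. prob (?E n)) sums prob (\<Union>n. ?E n)"
    by (rule finite_measure_UNION)
  \<comment> \<open>One factor \<open>p\<close> is pulled out so that the geometric series starts at
    exponent 0; it converges since \<open>p \<le> 1 - \<theta> < 1\<close>.\<close>
  moreover have "prob (?E n) = (\<theta> * p) * p ^ n" for n
    using theta by (subst prob_all_X_le_then_greater) (auto simp: p_def)
  moreover have "(\<lambda>n. (\<theta> * p) * p ^ n) sums ((\<theta> * p) * (1 / (1 - p)))"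
    using theta by (intro sums_mult geometric_sums) (auto simp: p_def)
  ultimately have "prob (\<Union>n. ?E n) = \<theta> * p / (1 - p)"
    by (simp add: sums_unique2)
  \<comment> \<open>The two events differ only where \<open>N = \<infinity>\<close>, a null
    event.\<close>
  moreover have "prob {\<omega> \<in> space M. 2 \<le> csug_N \<theta> X \<omega> \<and> csug_max \<theta> X \<omega> \<le> t} = prob (\<Union>n. ?E n)"
    unfolding U by (intro finite_measure_eq_AE) (use AE_csug_N_finite in auto)
  ultimately show ?thesis by simp
qed

text \<open>A law on the reals is determined by its values on half-lines, so it suffices to match
  distribution functions: the joint probability from \<open>prob_csug_max_le\<close> divided by
  \<open>prob ?A = 1 - \<theta>\<close>, against the integral of the density.\<close>

lemma distributed_csug_max:
  "distributed (uniform_measure M {\<omega> \<in> space M. csug_N \<theta> X \<omega> \<ge> 2}) lborel (csug_max \<theta> X)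
     (\<lambda>y. ennreal (if 0 \<le> y \<and> y \<le> 1 - \<theta> then \<theta> / ((1 - \<theta>) * (1 - y)\<^sup>2) else 0))"
proof -
  let ?A = "{\<omega> \<in> space M. csug_N \<theta> X \<omega> \<ge> 2}"
  have [measurable]: "csug_N \<theta> X \<in> M \<rightarrow>\<^sub>M count_space UNIV" "csug_max \<theta> X \<in> borel_measurable M"
    by (simp_all add: measurable_csug_N borel_measurable_csug_max)
  have A: "prob ?A = 1 - \<theta>"
    using prob_X_le[of 1 "1 - \<theta>"] theta by (simp add: two_le_csug_N_iff)
  let ?p = "\<lambda>t. max 0 (min t (1 - \<theta>))"
  show ?thesis
  proof (rule distributedI_borel_atMost[where g = "\<lambda>t. \<theta> * ?p t / ((1 - \<theta>) * (1 - ?p t))"])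
    fix t :: real
    show "(\<integral>\<^sup>+y. ennreal ((if 0 \<le> y \<and> y \<le> 1 - \<theta> then \<theta> / ((1 - \<theta>) * (1 - y)\<^sup>2) else 0)
            * indicator {..t} y) \<partial>lborel) = ennreal (\<theta> * ?p t / ((1 - \<theta>) * (1 - ?p t)))"
      by (rule nn_integral_csug_density_atMost) (use theta in auto)
    have "?A \<inter> {\<omega> \<in> space M. csug_max \<theta> X \<omega> \<le> t} =
        {\<omega> \<in> space M. 2 \<le> csug_N \<theta> X \<omega> \<and> csug_max \<theta> X \<omega> \<le> t}" by auto
    then have "emeasure (uniform_measure M ?A) {\<omega> \<in> space M. csug_max \<theta> X \<omega> \<le> t} =
        ennreal (\<theta> * ?p t / (1 - ?p t)) / ennreal (1 - \<theta>)"
      by (simp add: emeasure_uniform_measure emeasure_eq_measure A prob_csug_max_le)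
    \<comment> \<open>The quotient of extended nonnegative reals becomes a real one because the
      numerator is nonnegative and \<open>1 - \<theta>\<close> is positive.\<close>
    also have "\<dots> = ennreal (\<theta> * ?p t / (1 - ?p t) / (1 - \<theta>))"
      using theta by (intro divide_ennreal divide_nonneg_nonneg) auto
    finally show "emeasure (uniform_measure M ?A) {\<omega> \<in> space (uniform_measure M ?A). csug_max \<theta> X \<omega> \<le> t} =
        ennreal (\<theta> * ?p t / ((1 - \<theta>) * (1 - ?p t)))"
      by (simp add: mult.commute)
  qed (use theta in auto)
qed

end

theorem proposition3p1:
  fixes M :: "'a measure" and X :: "nat \<Rightarrow> 'a \<Rightarrow> real" and \<theta> :: real
  assumes "prob_space M"
    and "0 < \<theta>" and "\<theta> < 1"
    and "prob_space.indep_vars M (\<lambda>_. borel) X {1..}"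
    and "\<And>i. i \<ge> 1 \<Longrightarrow> distr M borel (X i) = uniform_measure lborel {0..1}"
  shows "distributed (uniform_measure M {\<omega> \<in> space M. csug_N \<theta> X \<omega> \<ge> 2}) lborel (csug_max \<theta> X)
           (\<lambda>y. ennreal (if 0 \<le> y \<and> y \<le> 1 - \<theta> then \<theta> / ((1 - \<theta>) * (1 - y)\<^sup>2) else 0))"
proof -
  interpret prob_space M by fact
  interpret csug M X \<theta> by unfold_locales (use assms in auto)
  show ?thesis by (rule distributed_csug_max)
qed

end
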